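(* Let $n\geq 1$ and let $\theta$ be a reflexive and transitive binary relation on $\{1,2,\ldots,n\}$. If $R$ is an arbitrary ring and $A\in M_{n}(\theta,R)$, then the preadjoint $A^{\ast}$ of $A$ satisfies $A^{\ast}\in M_{n}(\theta,R)$.
   Context: All rings are associative with identity (not necessarily commutative). $M_n(R)$ is the ring of $n\times n$ matrices over $R$. For a reflexive and transitive relation $\theta$ on $\{1,\ldots,n\}$, the structural matrix ring is the subring $M_{n}(\theta,R)=\{[a_{i,j}]\in M_{n}(R)\mid a_{i,j}=0\text{ if }(i,j)\notin\theta\}$ of $M_n(R)$. The preadjoint $A^{\ast}=[a_{r,s}^{\ast}]\in M_{n}(R)$ of a matrix $A=[a_{i,j}]\in M_{n}(R)$ is defined by $$a_{r,s}^{\ast}=\sum_{\tau,\rho}\mathrm{sgn}(\rho)\,a_{\tau(1),\rho(\tau(1))}\cdots a_{\tau(s-1),\rho(\tau(s-1))}\,a_{\tau(s+1),\rho(\tau(s+1))}\cdots a_{\tau(n),\rho(\tau(n))},$$ where the sum is taken over all permutations $\tau$ of the set $\{1,\ldots,s-1,s+1,\ldots,n\}$ and all permutations $\rho$ of the set $\{1,2,\ldots,n\}$ with $\rho(s)=r$ (the factors of each product are taken in the displayed order). *)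

theory Defs
  imports "Jordan_Normal_Form.Matrix" "HOL-Combinatorics.Permutations"
begin

text \<open>
  The sort \<open>{ring, monoid_mult}\<close> is that of associative, not necessarily commutative rings with
  identity; unlike \<open>ring_1\<close> it does not exclude the zero ring. Row and column indices are
  \<open>0, \<dots>, n - 1\<close>, following \<^typ>\<open>'a mat\<close>.
\<close>

definition structural_mats :: "nat \<Rightarrow> (nat \<times> nat) set \<Rightarrow> 'a :: {ring, monoid_mult} mat set" where
  "structural_mats n \<theta> =
     {A \<in> carrier_mat n n. \<forall>i<n. \<forall>j<n. (i, j) \<notin> \<theta> \<longrightarrow> A $$ (i, j) = 0}"

text \<open>
  Since multiplication need not commute, the product is taken over the list of positions
  \<open>0, \<dots>, s - 1, s + 1, \<dots>, n - 1\<close> in increasing order. The factor \<open>sgn \<rho>\<close> is the conditional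
  negation, as \<^term>\<open>of_int\<close> is not available without \<open>ring_1\<close>.
\<close>

definition preadjoint :: "'a :: {ring, monoid_mult} mat \<Rightarrow> 'a mat" where
  "preadjoint A =
     (let n = dim_row A in
      mat n n (\<lambda>(r, s).
        \<Sum>\<tau> | \<tau> permutes ({0..<n} - {s}).
          \<Sum>\<rho> | \<rho> permutes {0..<n} \<and> \<rho> s = r.
            let p = prod_list (map (\<lambda>k. A $$ (\<tau> k, \<rho> (\<tau> k))) (filter (\<lambda>k. k \<noteq> s) [0..<n]))
            in if evenperm \<rho> then p else - p))"

end

theory Submission imports Defs
begin

text \<open>
  Every summand of the \<open>(r, s)\<close> entry of the preadjoint is, up to sign, a product of the entries
  \<open>(k, \<rho> k)\<close> with \<open>k \<noteq> s\<close>, in an order given by \<open>\<tau>\<close>, where \<open>\<rho>\<close> is a permutation with \<open>\<rho> s = r\<close>.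
  If all these positions lay in \<open>\<theta>\<close>, then the cycle of \<open>\<rho>\<close> through \<open>s\<close> would give a chain
  \<open>r \<rightarrow> \<rho> r \<rightarrow> \<dots> \<rightarrow> s\<close> of steps in \<open>\<theta>\<close>, so \<open>(r, s) \<in> \<theta>\<close> by transitivity (by reflexivity when
  \<open>r = s\<close>). Hence for \<open>(r, s) \<notin> \<theta>\<close> every summand has a zero factor, and a product with a
  zero factor vanishes in whatever order it is taken.
  Lemma \<open>permutes_leaves_preorder\<close> provides the position of that factor.
\<close>

text \<open>
  Instead of following the cycle, consider the set of all \<open>x\<close> with \<open>(r, x) \<in> \<theta>\<close>,
  where \<open>r = \<rho> s\<close>. It omits \<open>s\<close>. If \<open>(k, \<rho> k) \<in> \<theta>\<close> for all \<open>k \<noteq> s\<close>, then \<open>\<rho>\<close>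
  maps this finite set into, hence onto, itself; so \<open>r\<close>, which lies in it by reflexivity, has its
  preimage \<open>s\<close> in it, a contradiction.
\<close>

lemma permutes_leaves_preorder:
  assumes perm: "\<rho> permutes S" and fin: "finite S"
    and refl: "refl_on S \<theta>" and trans: "trans \<theta>"
    and s: "s \<in> S" and not_in: "(\<rho> s, s) \<notin> \<theta>"
  obtains k where "k \<in> S" "k \<noteq> s" "(k, \<rho> k) \<notin> \<theta>"
proof (rule ccontr)
  assume "\<not> thesis"
  with that have step: "(k, \<rho> k) \<in> \<theta>" if "k \<in> S" "k \<noteq> s" for k
    using that by blast
  define U where "U = {x \<in> S. (\<rho> s, x) \<in> \<theta>}"
  have "\<rho> ` U \<subseteq> U"
  proof
    fix y assume "y \<in> \<rho> ` U"
    then obtain k where k: "k \<in> S" "(\<rho> s, k) \<in> \<theta>" "y = \<rho> k"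
      by (auto simp: U_def)
    with not_in have "(k, y) \<in> \<theta>" by (auto intro: step)
    with k trans have "(\<rho> s, y) \<in> \<theta>" by (blast dest: transD)
    moreover have "y \<in> S" using k perm by (simp add: permutes_in_image)
    ultimately show "y \<in> U" by (simp add: U_def)
  qed
  moreover have "inj \<rho>" using perm by (rule permutes_inj)
  moreover have "finite U" using fin by (simp add: U_def)
  ultimately have "\<rho> ` U = U"
    by (meson endo_inj_surj inj_on_subset subset_UNIV)
  moreover have "\<rho> s \<in> U"
    using s perm refl by (simp add: U_def permutes_in_image refl_onD)
  ultimately have "s \<in> U"
    using \<open>inj \<rho>\<close> by (metis inj_image_mem_iff)
  with not_in show False by (simp add: U_def)
qed

lemma prod_list_eq_0_if_mem:
  fixes xs :: "'a :: {ring, monoid_mult} list"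
  assumes "0 \<in> set xs"
  shows "prod_list xs = 0"
  using assms by (induction xs) auto

lemma preadjoint_product_eq_0:
  fixes A :: "'a :: {ring, monoid_mult} mat"
  assumes refl: "refl_on {0..<n} \<theta>" and trans: "trans \<theta>"
    and A: "A \<in> structural_mats n \<theta>"
    and \<tau>: "\<tau> permutes ({0..<n} - {s})" and \<rho>: "\<rho> permutes {0..<n}"
    and s: "s < n" and not_in: "(\<rho> s, s) \<notin> \<theta>"
  shows "prod_list (map (\<lambda>k. A $$ (\<tau> k, \<rho> (\<tau> k))) (filter (\<lambda>k. k \<noteq> s) [0..<n])) = 0"
proof (rule prod_list_eq_0_if_mem)
  obtain k where k: "k \<in> {0..<n} - {s}" and "(k, \<rho> k) \<notin> \<theta>"
    using permutes_leaves_preorder[OF \<rho> _ refl trans _ not_in] s by auto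
  moreover have "\<rho> k < n"
    using k permutes_in_image[OF \<rho>, of k] by simp
  ultimately have zero: "A $$ (k, \<rho> k) = 0"
    using A by (simp add: structural_mats_def)
  obtain j where "j \<in> {0..<n} - {s}" "\<tau> j = k"
    using k permutes_image[OF \<tau>] by (metis imageE)
  with zero show "0 \<in> set (map (\<lambda>k. A $$ (\<tau> k, \<rho> (\<tau> k))) (filter (\<lambda>k. k \<noteq> s) [0..<n]))"
    by force
qed

theorem theorem3p6:
  fixes n :: nat and \<theta> :: "(nat \<times> nat) set" and A :: "'a :: {ring, monoid_mult} mat"
  assumes "n \<ge> 1"
    and "\<theta> \<subseteq> {0..<n} \<times> {0..<n}"
    and "refl_on {0..<n} \<theta>"
    and "trans \<theta>"
    and "A \<in> structural_mats n \<theta>"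
  shows "preadjoint A \<in> structural_mats n \<theta>"
proof -
  have dim: "dim_row A = n"
    using assms(5) by (auto simp: structural_mats_def)
  have "preadjoint A $$ (r, s) = 0" if "r < n" "s < n" "(r, s) \<notin> \<theta>" for r s
    using that preadjoint_product_eq_0[OF assms(3-5)]
    by (auto simp: preadjoint_def dim Let_def intro!: sum.neutral)
  moreover have "preadjoint A \<in> carrier_mat n n"
    by (simp add: preadjoint_def dim Let_def)
  ultimately show ?thesis
    by (simp add: structural_mats_def)
qed

end
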